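(* $$\sum_{m,n=1}^\infty\ \lim_{X\rightarrow \infty}\frac{1}{X}\sum_{x=1}^X \frac{\mu(m)\mu(n)}{mn}\left(\left\{\frac{x}{n}\right\}\left\{\frac{x}{m}\right\}-\left\{\frac{2x}{n}\right\}\left\{\frac{x}{m}\right\}-\left\{\frac{x}{n}\right\}\left\{\frac{2x}{m}\right\}+\left\{\frac{2x}{n}\right\}\left\{\frac{2x}{m}\right\}\right)=\frac{1}{6\zeta(2)}-\frac{1}{6\zeta(2)^2},$$ where for each pair $(m,n)$ the limit over positive integers $X$ is taken first (the inner sum being over integers $x$), and the sum over all pairs of positive integers $(m,n)$ is taken afterwards.
   Context: $\mu$ is the Möbius function on positive integers, $\zeta$ is the Riemann zeta function, and $\{y\}=y-[y]$ denotes the fractional part of a real number $y$, with $[y]$ the integer part (floor). *)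

theory Defs
  imports "HOL-Analysis.Analysis" "HOL-Computational_Algebra.Squarefree"
begin

definition moebius_mu :: "nat \<Rightarrow> int" where
  "moebius_mu n = (if squarefree n then (-1) ^ card (prime_factors n) else 0)"

(* The Dirichlet series of the Riemann zeta function. It represents zeta for real s > 1 only;
   the analytic continuation is not modelled. *)
definition riemann_zeta :: "real \<Rightarrow> real" where
  "riemann_zeta s = (\<Sum>k. 1 / real (Suc k) powr s)"

definition mean_term :: "nat \<Rightarrow> nat \<Rightarrow> nat \<Rightarrow> real" where
  "mean_term m n X =
     1 / real X * (\<Sum>x=1..X.
       real_of_int (moebius_mu m) * real_of_int (moebius_mu n) / (real m * real n) *
       (frac (real x / real n) * frac (real x / real m)
        - frac (2 * real x / real n) * frac (real x / real m)
        - frac (real x / real n) * frac (2 * real x / real m)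
        + frac (2 * real x / real n) * frac (2 * real x / real m)))"

end

theory Submission
  imports Defs "HOL-Number_Theory.Cong"
begin

text \<open>Write \<open>s\<^sub>n(x) = {x/n} - {2x/n}\<close>, so that the term for \<open>(m, n)\<close> is
  \<open>\<mu>(m) \<mu>(n) / (m n)\<close> times the mean value of \<open>s\<^sub>m s\<^sub>n\<close>. With \<open>d = gcd(m, n)\<close>, the Chinese remainder
  theorem reduces this mean to a sum over the residues \<open>r\<close> modulo \<open>d\<close> of products of the sums of
  \<open>s\<^sub>m\<close> and of \<open>s\<^sub>n\<close> over the class of \<open>r\<close>. By Hermite's identity the sum of \<open>s\<^sub>m\<close> is \<open>s\<^sub>d(r)\<close> if \<open>m/d\<close>
  is odd and \<open>1/2 - {r/d}\<close> if it is even. Only \<open>m\<close> and \<open>n\<close> that are odd or twice an odd number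
  contribute, and for odd \<open>m\<close>, \<open>n\<close> the terms at \<open>(m, n)\<close>, \<open>(2m, n)\<close>, \<open>(m, 2n)\<close>, \<open>(2m, 2n)\<close> are combinations of
  \<open>\<mu>(m) \<mu>(n) / lcm(m, n)\<^sup>2\<close> and \<open>\<mu>(m) \<mu>(n) / (m n)\<^sup>2\<close>. By Moebius inversion these sum over odd \<open>m\<close>, \<open>n\<close> to
  \<open>A\<close> and \<open>A\<^sup>2\<close>, where \<open>1/A = 3 \<zeta>(2) / 4\<close> is the sum of \<open>1/k\<^sup>2\<close> over odd \<open>k\<close>.\<close>

section \<open>Moebius function: doubling and divisor sums\<close>

text \<open>For odd \<open>n\<close> the factor 2 adds one new prime and flips the sign; for even
  \<open>n\<close> the square 4 divides \<open>2 * n\<close>.\<close>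

lemma moebius_mu_double:
  "moebius_mu (2 * n) = (if odd n then - moebius_mu n else 0)"
proof (cases "odd n")
  case True
  then have "coprime 2 n" "n \<noteq> 0" by (auto intro: Nat.gr0I)
  then have sqf: "squarefree (2 * n) \<longleftrightarrow> squarefree n"
    using squarefree_mult_coprime[of 2 n] squarefree_prime[of "2::nat"] squarefree_multD by auto
  have "prime_factors (2 * n) = insert 2 (prime_factors n)" "2 \<notin> prime_factors n"
    using True \<open>n \<noteq> 0\<close> by (auto simp: prime_factorization_mult prime_factorization_prime)
  then show ?thesis
    using True by (simp add: moebius_mu_def sqf)
next
  case False
  then obtain k where "n = 2 * k" by (auto elim: evenE)
  then have "2\<^sup>2 dvd 2 * n" by (simp add: power2_eq_square)
  then have "\<not> squarefree (2 * n)" by (rule not_squarefreeI) simp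
  with False show ?thesis by (simp add: moebius_mu_def)
qed

text \<open>Taking products identifies the sets \<open>S\<close> of prime factors of
  \<open>L\<close> with its squarefree divisors, and \<open>moebius_mu\<close> becomes
  \<open>(-1) ^ card S\<close>. The sum over all \<open>S\<close> is the expansion of the product of
  \<open>1 - 1\<close> over the prime factors, which is empty exactly for
  \<open>L = 1\<close>.\<close>

lemma sum_moebius_mu_divisors:
  assumes "L > 0"
  shows "(\<Sum>m | m dvd L. moebius_mu m) = (if L = 1 then 1 else 0)"
proof -
  let ?P = "prime_factors L"
  have [simp]: "finite S" if "S \<in> Pow ?P" for S
    using that finite_subset by blast
  have pf: "prime_factors (\<Prod>S) = S" if "S \<in> Pow ?P" for S
  proof -
    have "prime_factors (\<Prod>p\<in>S. p) = \<Union>((prime_factors \<circ> (\<lambda>p. p)) ` S)"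
      using that by (intro prime_factors_prod) (auto simp: in_prime_factors_iff)
    also have "\<dots> = (\<Union>p\<in>S. {p})"
      using that by (intro SUP_cong) (auto simp: prime_factorization_prime in_prime_factors_iff subset_iff)
    finally show ?thesis by simp
  qed
  have sqf: "squarefree (\<Prod>S)" if "S \<in> Pow ?P" for S
    using that
    by (intro squarefree_prod_coprime) (auto simp: in_prime_factors_iff primes_coprime subset_iff intro: squarefree_prime)
  have "bij_betw Prod (Pow ?P) {m. m dvd L \<and> squarefree m}"
  proof (rule bij_betwI[where g = prime_factors])
    show "Prod \<in> Pow ?P \<rightarrow> {m. m dvd L \<and> squarefree m}"
    proof safe
      fix S assume S: "S \<subseteq> ?P"
      have "\<Prod>S dvd \<Prod>?P"
        using S by (intro prod_dvd_prod_subset) auto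
      also have "\<Prod>?P dvd (\<Prod>p\<in>?P. p ^ multiplicity p L)"
        using assms by (intro prod_dvd_prod dvd_power) (auto simp: prime_factors_multiplicity)
      also have "\<dots> = L" using assms by (simp add: prod_prime_factors)
      finally show "\<Prod>S dvd L" .
      show "squarefree (\<Prod>S)" using S sqf by auto
    qed
    show "prime_factors \<in> {m. m dvd L \<and> squarefree m} \<rightarrow> Pow ?P"
      using assms dvd_prime_factors[of L] by blast
    show "prime_factors (\<Prod>S) = S" if "S \<in> Pow ?P" for S by (rule pf) fact
    show "\<Prod>(prime_factors m) = m" if "m \<in> {m. m dvd L \<and> squarefree m}" for m
    proof -
      have m: "m \<noteq> 0" "squarefree m" using that assms by auto
      then have "(\<Prod>p\<in>prime_factors m. p ^ multiplicity p m) = (\<Prod>p\<in>prime_factors m. p)"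
        by (intro prod.cong) (auto simp: squarefree_factorial_semiring')
      with m show ?thesis by (simp add: prod_prime_factors)
    qed
  qed
  then have "(\<Sum>S\<in>Pow ?P. moebius_mu (\<Prod>S)) = (\<Sum>m | m dvd L \<and> squarefree m. moebius_mu m)"
    by (rule sum.reindex_bij_betw)
  also have "\<dots> = (\<Sum>m | m dvd L. moebius_mu m)"
    using assms by (intro sum.mono_neutral_left) (auto simp: moebius_mu_def)
  also have "(\<Sum>S\<in>Pow ?P. moebius_mu (\<Prod>S)) = (\<Sum>S\<in>Pow ?P. (-1) ^ card S)"
    by (intro sum.cong refl) (simp add: moebius_mu_def pf sqf)
  also have "\<dots> = (\<Prod>p\<in>?P. 1 - 1)"
    by (subst prod_diff_conv_sum) simp_all
  also have "\<dots> = (if ?P = {} then 1 else 0)"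
    by (simp add: card_gt_0_iff power_0_left)
  also have "?P = {} \<longleftrightarrow> L = 1"
    using assms by (auto simp: prime_factorization_empty_iff)
  finally show ?thesis by simp
qed

section \<open>Unconditional sums over odd integers and Moebius inversion\<close>

lemma summable_on_Times:
  fixes f :: "'a \<Rightarrow> real" and g :: "'b \<Rightarrow> real"
  assumes "f summable_on A" "g summable_on B"
  shows "(\<lambda>(x, y). f x * g y) summable_on A \<times> B"
proof (rule abs_summable_summable)
  have "(\<lambda>x. norm (f x)) summable_on A" "(\<lambda>y. norm (g y)) summable_on B"
    using assms by (auto intro: summable_on_iff_abs_summable_on_real[THEN iffD1, simplified])
  then show "(\<lambda>p. norm (case p of (x, y) \<Rightarrow> f x * g y)) summable_on A \<times> B"
    by (subst Infinite_Sum.abs_summable_on_Sigma_iff)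
      (auto simp: abs_mult infsum_cmult_right' infsum_nonneg
        intro!: summable_on_cmult_right summable_on_cmult_left)
qed

text \<open>Summability on the product gives some value \<open>s\<close>; summing over
  \<open>y\<close> first and then over \<open>x\<close> identifies it.\<close>

lemma has_sum_Times:
  fixes f :: "'a \<Rightarrow> real" and g :: "'b \<Rightarrow> real"
  assumes "(f has_sum a) A" "(g has_sum b) B"
  shows "((\<lambda>(x, y). f x * g y) has_sum (a * b)) (A \<times> B)"
proof -
  have "(\<lambda>(x, y). f x * g y) summable_on A \<times> B"
    by (intro summable_on_Times) (use assms has_sum_imp_summable in blast)+
  then obtain s where s: "((\<lambda>(x, y). f x * g y) has_sum s) (A \<times> B)"
    by (auto simp: summable_on_def)
  have "((\<lambda>x. f x * b) has_sum s) A"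
    by (rule has_sum_SigmaD[OF s]) (auto intro: has_sum_cmult_right assms)
  then have "s = a * b"
    using has_sum_cmult_left[OF assms(1), of b] has_sum_unique by blast
  with s show ?thesis by simp
qed

text \<open>The term at \<open>k = 0\<close> is 0 because division by zero gives zero, so
  \<open>A\<close> may contain 0.\<close>

lemma summable_inverse_squares: "(\<lambda>k::nat. 1 / (real k)\<^sup>2) summable_on A"
proof -
  have "summable (\<lambda>k. 1 / (real k)\<^sup>2)"
    using inverse_power_summable[of 2, where 'a = real] by (simp add: divide_inverse)
  then show ?thesis
    using summable_nonneg_imp_summable_on[of "\<lambda>k. 1 / (real k)\<^sup>2"] summable_on_subset_banach by fastforce
qed

lemma has_sum_odd_inverse_squares:
  "((\<lambda>k. 1 / (real k)\<^sup>2) has_sum (3 / 4 * riemann_zeta 2)) {k. odd k}"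
proof -
  define f where "f = (\<lambda>k::nat. 1 / (real k)\<^sup>2)"
  have "(\<lambda>k. f (Suc k)) summable_on UNIV"
    using summable_inverse_squares[of "range Suc"] by (subst (asm) summable_on_reindex) (auto simp: f_def o_def)
  then obtain z where z: "((\<lambda>k. f (Suc k)) has_sum z) UNIV" by (auto simp: summable_on_def)
  then have "(\<lambda>k. f (Suc k)) sums z" by (rule has_sum_imp_sums)
  then have "z = riemann_zeta 2"
    by (simp add: riemann_zeta_def f_def sums_iff powr_numeral)
  moreover have *: "(f has_sum z) (range Suc)"
    using z by (subst has_sum_reindex) (auto simp: o_def)
  \<comment> \<open>The even terms form a copy of the whole series scaled by 1/4, which leaves 3/4
    of it to the odd terms.\<close>
  moreover have "((f \<circ> (*) 2) has_sum (z / 4)) (range Suc)"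
    using has_sum_cmult_right[OF *, of "1/4"] by (simp add: f_def o_def power_mult_distrib)
  then have even: "(f has_sum (z / 4)) ((*) 2 ` range Suc)"
    by (subst has_sum_reindex) (auto intro: inj_onI)
  have disj: "{k. odd k} \<inter> (*) 2 ` range Suc = {}" by auto
  obtain s where s: "(f has_sum s) {k. odd k}"
    using summable_inverse_squares unfolding f_def summable_on_def by blast
  have pos: "range Suc = {k. k > 0}"
    by (auto simp: image_iff gr0_conv_Suc)
  have "range Suc = {k. odd k} \<union> (*) 2 ` range Suc"
    unfolding pos by (auto elim!: evenE intro: odd_pos)
  then have "(f has_sum (s + z / 4)) (range Suc)"
    using has_sum_Un_disjoint[OF s even disj] by metis
  then have "s + z / 4 = z" using * has_sum_unique by blast
  ultimately have "s = 3 / 4 * riemann_zeta 2" by simp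
  with s show ?thesis by (simp add: f_def)
qed

text \<open>Multiplying by the sum of \<open>1 / k\<^sup>2\<close> over odd \<open>k\<close> and collecting the pairs \<open>(i, k)\<close> by \<open>L = q i * k\<close>
  leaves only the contribution of \<open>L = 1\<close>.\<close>

lemma has_sum_odd_moebius_inversion:
  fixes w :: "'i \<Rightarrow> real" and q :: "'i \<Rightarrow> nat"
  assumes summable: "(\<lambda>i. w i / (real (q i))\<^sup>2) summable_on I"
    and odd: "\<And>i. i \<in> I \<Longrightarrow> odd (q i)"
    and fin: "\<And>L. odd L \<Longrightarrow> finite {i\<in>I. q i dvd L}"
    and inv: "\<And>L. odd L \<Longrightarrow> (\<Sum>i | i \<in> I \<and> q i dvd L. w i) = (if L = 1 then 1 else 0)"
  shows "((\<lambda>i. w i / (real (q i))\<^sup>2) has_sum (4 / (3 * riemann_zeta 2))) I"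
proof -
  define h where "h = (\<lambda>i. w i / (real (q i))\<^sup>2)"
  obtain s where s: "(h has_sum s) I"
    using summable by (auto simp: h_def summable_on_def)
  have pos: "q i > 0" if "i \<in> I" for i
    using odd[OF that] odd_pos by blast
  have odd_div: "odd (L div q i)" if "odd L" "i \<in> I" "q i dvd L" for i L
    using that by (metis dvd_mult_div_cancel even_mult_iff)
  have "((\<lambda>(i, k). h i * (1 / (real k)\<^sup>2)) has_sum (s * (3 / 4 * riemann_zeta 2))) (I \<times> {k. odd k})"
    by (rule has_sum_Times[OF s has_sum_odd_inverse_squares])
  \<comment> \<open>With \<open>L = q i * k\<close> the summand is \<open>w i / L^2\<close>. The
    pair \<open>(L, i)\<close> determines \<open>k = L div q i\<close>, which is odd because
    \<open>L\<close> is.\<close>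
  also have "?this \<longleftrightarrow> ((\<lambda>(L, i). w i / (real L)\<^sup>2) has_sum (s * (3 / 4 * riemann_zeta 2)))
      (SIGMA L:{L. odd L}. {i\<in>I. q i dvd L})"
    by (rule has_sum_reindex_bij_witness[where j = "\<lambda>(i, k). (q i * k, i)" and i = "\<lambda>(L, i). (i, L div q i)"])
      (use odd pos odd_div in \<open>auto simp: h_def power_mult_distrib\<close>)
  finally have "((\<lambda>L. if L = 1 then 1 else 0) has_sum (s * (3 / 4 * riemann_zeta 2))) {L::nat. odd L}"
  proof (rule has_sum_SigmaD)
    fix L :: nat assume "L \<in> {L. odd L}"
    then show "((\<lambda>i. case (L, i) of (L, i) \<Rightarrow> w i / (real L)\<^sup>2) has_sum (if L = 1 then 1 else 0)) {i\<in>I. q i dvd L}"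
      using fin[of L] inv[of L] by (intro has_sum_finiteI) (auto simp flip: sum_divide_distrib)
  qed
  moreover have "((\<lambda>L. if L = 1 then 1 else 0 :: real) has_sum 1) {L::nat. odd L}"
    by (rule has_sum_finite_neutralI[of "{1}"]) auto
  ultimately have "s * (3 / 4 * riemann_zeta 2) = 1"
    by (rule has_sum_unique)
  \<comment> \<open>The preceding equation also excludes \<open>riemann_zeta 2 = 0\<close>, since
    its right-hand side is 1.\<close>
  then have "s = 4 / (3 * riemann_zeta 2)"
    by (cases "riemann_zeta 2 = 0") (auto simp: field_simps)
  with s show ?thesis by (simp add: h_def)
qed

lemma summable_on_norm_comparison:
  fixes f g :: "'a \<Rightarrow> real"
  assumes "g summable_on A" "\<And>x. x \<in> A \<Longrightarrow> \<bar>f x\<bar> \<le> g x"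
  shows "f summable_on A"
  by (rule abs_summable_summable, rule Infinite_Sum.abs_summable_on_comparison_test'[OF assms(1)]) (use assms(2) in simp)

lemma abs_moebius_mu_le: "\<bar>real_of_int (moebius_mu n)\<bar> \<le> 1"
  by (simp add: moebius_mu_def power_abs)

lemma sum_odd_divisors_moebius_mu:
  assumes "odd L"
  shows "(\<Sum>m | m \<in> {m. odd m} \<and> m dvd L. real_of_int (moebius_mu m)) = (if L = 1 then 1 else 0)"
proof -
  have "{m. m \<in> {m. odd m} \<and> m dvd L} = {m. m dvd L}"
    using assms dvd_trans by blast
  then show ?thesis
    using sum_moebius_mu_divisors[of L] assms odd_pos[of L] by (simp flip: of_int_sum)
qed

lemma has_sum_odd_moebius_mu:
  "((\<lambda>m. real_of_int (moebius_mu m) / (real m)\<^sup>2) has_sum (4 / (3 * riemann_zeta 2))) {m. odd m}"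
proof (rule has_sum_odd_moebius_inversion)
  show "(\<lambda>m. real_of_int (moebius_mu m) / (real m)\<^sup>2) summable_on {m. odd m}"
    using summable_inverse_squares
    by (rule summable_on_norm_comparison) (use abs_moebius_mu_le in \<open>auto simp: divide_right_mono\<close>)
qed (use sum_odd_divisors_moebius_mu in \<open>auto simp: odd_pos intro: finite_subset[OF _ finite_divisors_nat]\<close>)

text \<open>With \<open>d = gcd m n\<close>, \<open>m = d * a\<close> and \<open>n = d * b\<close>,
  the lcm is \<open>d * a * b\<close>. The pair determines and is determined by the triple
  \<open>(d, a, b)\<close>, so the series is part of the triple product of the series of inverse
  squares.\<close>

lemma summable_inverse_lcm_squared:
  "(\<lambda>(m, n). 1 / (real (lcm m n))\<^sup>2) summable_on {m. odd m} \<times> {n. odd n}"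
proof -
  define f where "f = (\<lambda>k::nat. 1 / (real k)\<^sup>2)"
  define h where "h = (\<lambda>(m::nat, n). (gcd m n, m div gcd m n, n div gcd m n))"
  have f: "f summable_on UNIV" using summable_inverse_squares by (simp add: f_def)
  have "(\<lambda>(d, p). f d * (\<lambda>(a, b). f a * f b) p) summable_on UNIV \<times> (UNIV \<times> UNIV)"
    by (intro summable_on_Times f)
  then have "(\<lambda>(d, p). f d * (\<lambda>(a, b). f a * f b) p) summable_on h ` ({m. odd m} \<times> {n. odd n})"
    by (rule summable_on_subset_banach) auto
  moreover have "inj_on h ({m. odd m} \<times> {n. odd n})"
    by (rule inj_on_inverseI[where g = "\<lambda>(d, a, b). (d * a, d * b)"]) (auto simp: h_def)
  ultimately have "(\<lambda>(d, p). f d * (\<lambda>(a, b). f a * f b) p) \<circ> h summable_on {m. odd m} \<times> {n. odd n}"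
    by (simp add: summable_on_reindex)
  also have "?this \<longleftrightarrow> (\<lambda>(m, n). 1 / (real (lcm m n))\<^sup>2) summable_on {m. odd m} \<times> {n. odd n}"
  proof (intro summable_on_cong, clarify)
    fix m n :: nat
    have "lcm m n = m * (n div gcd m n)"
      by (simp add: lcm_nat_def div_mult_swap)
    also have "\<dots> = gcd m n * (m div gcd m n) * (n div gcd m n)" by simp
    finally have lcm: "real (lcm m n) = real (gcd m n) * real (m div gcd m n) * real (n div gcd m n)"
      by (simp only: of_nat_mult)
    show "((\<lambda>(d, p). f d * (\<lambda>(a, b). f a * f b) p) \<circ> h) (m, n) = 1 / (real (lcm m n))\<^sup>2"
      unfolding lcm by (simp add: f_def h_def power_mult_distrib)
  qed
  finally show ?thesis .
qed

text \<open>Since \<open>lcm m n\<close> divides \<open>L\<close> iff both \<open>m\<close> and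
  \<open>n\<close> do, the divisor sum over pairs is the square of the one over single integers. The
  square of the indicator of \<open>L = 1\<close> is that indicator again, hence the same value as
  for one variable.\<close>

lemma has_sum_odd_moebius_mu_lcm:
  "((\<lambda>(m, n). real_of_int (moebius_mu m) * real_of_int (moebius_mu n) / (real (lcm m n))\<^sup>2)
     has_sum (4 / (3 * riemann_zeta 2))) ({m. odd m} \<times> {n. odd n})"
proof -
  let ?w = "\<lambda>(m, n). real_of_int (moebius_mu m) * real_of_int (moebius_mu n)"
  let ?q = "\<lambda>(m, n). lcm m n :: nat"
  have divs: "{i \<in> {m. odd m} \<times> {n. odd n}. ?q i dvd L} =
      {m. m \<in> {m. odd m} \<and> m dvd L} \<times> {m. m \<in> {m. odd m} \<and> m dvd L}" for L
    by auto
  have "((\<lambda>i. ?w i / (real (?q i))\<^sup>2) has_sum (4 / (3 * riemann_zeta 2))) ({m. odd m} \<times> {n. odd n})"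
  proof (rule has_sum_odd_moebius_inversion)
    show "(\<lambda>i. ?w i / (real (?q i))\<^sup>2) summable_on {m. odd m} \<times> {n. odd n}"
      using summable_inverse_lcm_squared
      by (rule summable_on_norm_comparison)
        (use abs_moebius_mu_le in \<open>auto simp: abs_mult intro!: divide_right_mono mult_le_one\<close>)
    show "odd (?q i)" if i: "i \<in> {m. odd m} \<times> {n. odd n}" for i
    proof -
      obtain m n where "i = (m, n)" "odd (m * n)" using i by auto
      moreover have "lcm m n dvd m * n" by (intro lcm_least) auto
      ultimately show ?thesis by (metis case_prod_conv dvd_trans)
    qed
    fix L :: nat assume L: "odd L"
    then have "finite {m. m \<in> {m. odd m} \<and> m dvd L}"
      by (auto simp: odd_pos intro: finite_subset[OF _ finite_divisors_nat])
    then show "finite {i \<in> {m. odd m} \<times> {n. odd n}. ?q i dvd L}"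
      unfolding divs by simp
    show "(\<Sum>i | i \<in> {m. odd m} \<times> {n. odd n} \<and> ?q i dvd L. ?w i) = (if L = 1 then 1 else 0)"
      unfolding divs sum.cartesian_product[symmetric] sum_product[symmetric]
        sum_odd_divisors_moebius_mu[OF L] by simp
  qed
  then show ?thesis by (simp add: case_prod_unfold)
qed

section \<open>The functions \<open>saw n\<close> and their sums over arithmetic
  progressions\<close>

text \<open>The four products of fractional parts in \<open>mean_term m n\<close> combine to
  \<open>saw m x * saw n x\<close>.\<close>

definition saw :: "nat \<Rightarrow> nat \<Rightarrow> real" where
  "saw n x = frac (real x / real n) - frac (2 * real x / real n)"

lemma frac_div_nat: "frac (real x / real n) = real (x mod n) / real n"
proof (cases "n = 0")
  case False
  have "real x = real n * real (x div n) + real (x mod n)"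
    by (metis mult_div_mod_eq of_nat_add of_nat_mult)
  then have "real x / real n = real (x div n) + real (x mod n) / real n"
    using False by (simp add: field_simps)
  then show ?thesis
    by (simp add: frac_def floor_divide_of_nat_eq)
qed simp

lemma saw_altdef: "saw n x = real (x mod n) / real n - real ((2 * x) mod n) / real n"
  using frac_div_nat[of x n] frac_div_nat[of "2 * x" n] by (simp add: saw_def)

lemma saw_mod: "saw n (x mod n) = saw n x"
  by (simp add: saw_altdef mod_mult_right_eq)

lemma bij_betw_affine_mod:
  fixes a c q :: nat
  assumes "coprime c a" "a > 0"
  shows "bij_betw (\<lambda>i. (q + c * i) mod a) {..<a} {..<a}"
proof -
  have "inj_on (\<lambda>i. (q + c * i) mod a) {..<a}"
  proof (rule inj_onI)
    fix i j assume "i \<in> {..<a}" "j \<in> {..<a}" "(q + c * i) mod a = (q + c * j) mod a"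
    then have "[q + c * i = q + c * j] (mod a)" by (simp add: cong_def)
    then have "[i = j] (mod a)"
      using assms cong_add_lcancel_nat cong_mult_lcancel_nat by blast
    with \<open>i \<in> _\<close> \<open>j \<in> _\<close> show "i = j" by (simp add: cong_def)
  qed
  moreover from this have "(\<lambda>i. (q + c * i) mod a) ` {..<a} = {..<a}"
    using assms by (intro endo_inj_surj) auto
  ultimately show ?thesis by (simp add: bij_betw_def)
qed

text \<open>Reducing \<open>r + c * d * i\<close> modulo \<open>d * a\<close> keeps the residue
  \<open>r mod d\<close> and adds \<open>d\<close> times a residue modulo \<open>a\<close>, which
  runs through all of \<open>{..<a}\<close> as \<open>c\<close> is coprime to \<open>a\<close>. For
  \<open>c = 1\<close> this is Hermite's identity; \<open>c = 2\<close> serves the terms with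
  \<open>2 * x\<close>.\<close>

lemma sum_frac_progression:
  assumes "coprime c a" "a > 0" "d > 0"
  shows "(\<Sum>i<a. frac (real (r + c * d * i) / real (d * a))) = frac (real r / real d) + (real a - 1) / 2"
proof -
  have eq: "(r + c * d * i) mod (d * a) = r mod d + d * ((r div d + c * i) mod a)" for i
  proof -
    have "r + c * d * i = r mod d + d * (r div d + c * i)"
      by (simp add: algebra_simps)
    moreover have "\<dots> mod (d * a) = d * ((r div d + c * i) mod a) + r mod d"
      using assms by (subst mod_mult2_eq) simp
    ultimately show ?thesis by simp
  qed
  have gauss: "(\<Sum>i<a. real i) = real a * (real a - 1) / 2" for a :: nat
    by (induction a) (auto simp: field_simps)
  have "(\<Sum>i<a. frac (real (r + c * d * i) / real (d * a))) =
        (\<Sum>i<a. (real (r mod d) + real d * real ((r div d + c * i) mod a)) / real (d * a))"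
    unfolding frac_div_nat eq by simp
  also have "\<dots> = (real a * real (r mod d) + real d * (\<Sum>i<a. real ((r div d + c * i) mod a))) / real (d * a)"
    by (simp add: sum.distrib sum_distrib_left flip: sum_divide_distrib)
  also have "(\<Sum>i<a. real ((r div d + c * i) mod a)) = (\<Sum>i<a. real i)"
    by (rule sum.reindex_bij_betw[OF bij_betw_affine_mod]) (use assms in auto)
  also have "(\<Sum>i<a. real i) = real a * (real a - 1) / 2"
    by (rule gauss)
  also have "(real a * real (r mod d) + real d * (real a * (real a - 1) / 2)) / real (d * a) =
      real (r mod d) / real d + (real a - 1) / 2"
    using assms by (simp add: field_simps)
  finally show ?thesis by (simp only: frac_div_nat)
qed

text \<open>As 2 is coprime to \<open>a\<close>, both fractional parts run through full
  progressions, and the two constants \<open>(a - 1) / 2\<close> cancel.\<close>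

lemma sum_saw_odd:
  assumes "odd a" "d > 0"
  shows "(\<Sum>i<a. saw (d * a) (r + d * i)) = saw d r"
proof -
  have "coprime 2 a" "a > 0" using assms by (auto intro: Nat.gr0I)
  then show ?thesis
    using sum_frac_progression[of 1 a d r] sum_frac_progression[of 2 a d "2 * r"] \<open>d > 0\<close>
    by (simp add: saw_def sum_subtractf distrib_left mult.assoc)
qed

lemma sum_lessThan_add: "sum f {..<m + n} = sum f {..<m} + (\<Sum>i<n. f (m + i))"
  for f :: "nat \<Rightarrow> 'a::comm_monoid_add" and m n :: nat
  by (induction n) (simp_all add: add.assoc)

text \<open>Doubling cancels the 2 in the denominator \<open>d * (2 * a)\<close>, so the second
  fractional part runs twice through a progression with \<open>a\<close> terms. What remains is
  \<open>{r/d} + (2 * a - 1) / 2 - 2 * ({r/d} + (a - 1) / 2)\<close>.\<close>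

lemma sum_saw_even:
  assumes "a > 0" "d > 0"
  shows "(\<Sum>i<2 * a. saw (d * (2 * a)) (r + d * i)) = 1 / 2 - frac (real r / real d)"
proof -
  have *: "frac (2 * real (r + d * i) / real (d * (2 * a))) = frac (real (r + d * i) / real (d * a))" for i
  proof -
    have "2 * real (r + d * i) / real (d * (2 * a)) = real (r + d * i) / real (d * a)"
      using mult_divide_mult_cancel_left[of 2 "real (r + d * i)" "real (d * a)"]
      by (simp add: mult.left_commute)
    then show ?thesis by simp
  qed
  have "(\<Sum>i<2 * a. frac (real (r + d * i) / real (d * (2 * a)))) = frac (real r / real d) + (2 * real a - 1) / 2"
    using sum_frac_progression[of 1 "2 * a" d r] assms by simp
  moreover have "(\<Sum>i<2 * a. frac (real (r + d * i) / real (d * a)))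
        = (\<Sum>i<a. frac (real (r + d * i) / real (d * a))) +
          (\<Sum>i<a. frac (real ((r + d * a) + d * i) / real (d * a)))"
    unfolding mult_2[of a] sum_lessThan_add by (simp add: algebra_simps)
  moreover have "frac (real (r + d * a) / real d) = frac (real r / real d)"
    unfolding frac_div_nat by simp
  then have "(\<Sum>i<a. frac (real (r + d * i) / real (d * a))) +
          (\<Sum>i<a. frac (real ((r + d * a) + d * i) / real (d * a)))
        = 2 * (frac (real r / real d) + (real a - 1) / 2)"
    using sum_frac_progression[of 1 a d r] sum_frac_progression[of 1 a d "r + d * a"] assms
    by simp
  ultimately show ?thesis
    unfolding saw_def sum_subtractf * by (simp add: field_simps)
qed

section \<open>Sums and mean values of periodic functions\<close>

text \<open>By the Chinese remainder theorem the residues modulo \<open>a\<close> and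
  \<open>b\<close> vary independently over one period \<open>a * b\<close>.\<close>

lemma sum_mult_periodic_coprime:
  fixes f g :: "nat \<Rightarrow> real"
  assumes "coprime a b" "a > 0" "b > 0"
    and f: "\<And>i. f (i mod a) = f i" and g: "\<And>i. g (i mod b) = g i"
  shows "(\<Sum>i<a * b. f i * g i) = sum f {..<a} * sum g {..<b}"
proof -
  let ?h = "\<lambda>i. (i mod a, i mod b)"
  have inj: "inj_on ?h {..<a * b}"
  proof (rule inj_onI)
    fix i j assume "i \<in> {..<a * b}" "j \<in> {..<a * b}" "?h i = ?h j"
    then have "[i = j] (mod a * b)"
      by (intro coprime_cong_mult_nat assms(1)) (auto simp: cong_def)
    with \<open>i \<in> _\<close> \<open>j \<in> _\<close> show "i = j" by (simp add: cong_def)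
  qed
  have "?h ` {..<a * b} = {..<a} \<times> {..<b}"
    by (rule card_subset_eq) (use assms in \<open>auto simp: card_image[OF inj] card_cartesian_product\<close>)
  with inj have "bij_betw ?h {..<a * b} ({..<a} \<times> {..<b})" by (simp add: bij_betw_def)
  then have "(\<Sum>i<a * b. (\<lambda>(x, y). f x * g y) (?h i)) = (\<Sum>(x, y)\<in>{..<a} \<times> {..<b}. f x * g y)"
    by (rule sum.reindex_bij_betw)
  then show ?thesis
    by (simp add: f g sum_product sum.cartesian_product)
qed

lemma sum_lessThan_mult: "sum f {..<d * k} = (\<Sum>r<d. \<Sum>i<k. f (r + d * i))"
  for f :: "nat \<Rightarrow> 'a::comm_monoid_add" and d k :: nat
proof (induction k)
  case (Suc k)
  have "sum f {..<d * Suc k} = sum f {..<d * k + d}" by (simp add: add.commute)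
  then show ?case
    unfolding sum_lessThan_add by (simp add: Suc sum.distrib add.commute)
qed simp

text \<open>On the residue class of \<open>r\<close> modulo \<open>d\<close>, the functions of
  \<open>i\<close> obtained from \<open>f\<close> and \<open>g\<close> have the coprime periods
  \<open>a\<close> and \<open>b\<close>, so the coprime case applies class by class.\<close>

lemma sum_mult_periodic:
  fixes f g :: "nat \<Rightarrow> real"
  assumes "coprime a b" "a > 0" "b > 0"
    and f: "\<And>i. f (i mod (d * a)) = f i" and g: "\<And>i. g (i mod (d * b)) = g i"
  shows "(\<Sum>i<d * (a * b). f i * g i) = (\<Sum>r<d. (\<Sum>i<a. f (r + d * i)) * (\<Sum>i<b. g (r + d * i)))"
proof -
  have mod: "(r + d * (i mod k)) mod (d * k) = (r + d * i) mod (d * k)" for r i k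
    by (metis mod_add_right_eq mod_mult_right_eq mult_mod_right mod_mod_trivial)
  have "f (r + d * (i mod a)) = f (r + d * i)" "g (r + d * (i mod b)) = g (r + d * i)" for r i
    by (metis f mod) (metis g mod)
  then show ?thesis
    unfolding sum_lessThan_mult[of _ d]
    by (intro sum.cong refl sum_mult_periodic_coprime) (use assms in auto)
qed

text \<open>The partial sums \<open>D\<close> of \<open>f - c\<close>, with \<open>c\<close> the
  average over a period, are periodic because a full period contributes 0. They are therefore
  bounded, and the mean differs from \<open>c\<close> by \<open>O(1/X)\<close>.\<close>

lemma tendsto_mean_periodic:
  fixes f :: "nat \<Rightarrow> real"
  assumes "N > 0" and f: "\<And>i. f (i mod N) = f i"
  shows "(\<lambda>X. (\<Sum>x=1..X. f x) / real X) \<longlonglongrightarrow> sum f {..<N} / real N"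
proof -
  define c where "c = sum f {..<N} / real N"
  define D where "D X = (\<Sum>x<X. f x - c)" for X
  have shift: "D (N + X) = D X" for X
  proof -
    have "f (N + i) = f i" for i by (metis f mod_add_self1)
    then show ?thesis
      using \<open>N > 0\<close> by (simp add: D_def sum_lessThan_add) (simp add: sum_subtractf c_def)
  qed
  have D_mod: "D X = D (X mod N)" for X
  proof (induction X rule: less_induct)
    case (less X)
    show ?case
    proof (cases "X < N")
      case False
      then have "D X = D (X - N)" using shift[of "X - N"] by simp
      with less[of "X - N"] False \<open>N > 0\<close> show ?thesis by (simp add: le_mod_geq)
    qed simp
  qed
  define K where "K = Max ((\<lambda>X. \<bar>D X\<bar>) ` {..<N})"
  have "\<bar>D X\<bar> \<le> K" for X
    unfolding K_def using \<open>N > 0\<close> by (subst D_mod, intro Max_ge) auto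
  then have "\<forall>X. norm (D (Suc X) * inverse (real X)) \<le> K * inverse (real X)"
    by (simp add: abs_mult mult_right_mono)
  moreover have "(\<lambda>X. K * inverse (real X)) \<longlonglongrightarrow> 0"
    by (rule tendsto_mult_right_zero) (rule lim_inverse_n)
  ultimately have "(\<lambda>X. D (Suc X) * inverse (real X)) \<longlonglongrightarrow> 0"
    by (rule Lim_null_comparison[OF always_eventually])
  \<comment> \<open>\<open>D (Suc X)\<close> starts at \<open>x = 0\<close> while the mean starts at
    \<open>x = 1\<close>; this term corrects for the extra summand \<open>f 0 - c\<close>.\<close>
  moreover have "(\<lambda>X. (c - f 0) * inverse (real X)) \<longlonglongrightarrow> 0"
    by (rule tendsto_mult_right_zero) (rule lim_inverse_n)
  ultimately have "(\<lambda>X. D (Suc X) * inverse (real X) + (c - f 0) * inverse (real X) + c) \<longlonglongrightarrow> 0 + 0 + c"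
    by (intro tendsto_intros)
  moreover have "\<forall>\<^sub>F X in sequentially.
      D (Suc X) * inverse (real X) + (c - f 0) * inverse (real X) + c = (\<Sum>x=1..X. f x) / real X"
    using eventually_gt_at_top[of 0]
  proof eventually_elim
    case (elim X)
    have "{..<Suc X} = insert 0 {1..X}" by auto
    then have "D (Suc X) = f 0 - c + (\<Sum>x=1..X. f x) - real X * c"
      by (simp add: D_def sum_subtractf algebra_simps)
    with elim show ?case by (simp add: field_simps)
  qed
  ultimately have "(\<lambda>X. (\<Sum>x=1..X. f x) / real X) \<longlonglongrightarrow> 0 + 0 + c"
    by (rule Lim_transform_eventually)
  then show ?thesis by (simp add: c_def)
qed

section \<open>Closed forms of the sums over one period\<close>

lemma saw_less:
  assumes "r < d"
  shows "saw d r = (if 2 * r < d then - (real r / real d) else 1 - real r / real d)"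
proof -
  have "(2 * r) mod d = 2 * r - d" if "\<not> 2 * r < d"
    using assms that by (simp add: le_mod_geq)
  then show ?thesis using assms by (auto simp: saw_altdef field_simps of_nat_diff)
qed

lemma sum_quadratic:
  "(\<Sum>r<k. \<alpha> + \<beta> * real r + \<gamma> * (real r)\<^sup>2) =
     real k * \<alpha> + \<beta> * (real k * (real k - 1) / 2) + \<gamma> * (real k * (real k - 1) * (2 * real k - 1) / 6)"
  by (induction k) (auto simp: field_simps power2_eq_square)

text \<open>The period splits at its middle into \<open>k\<close> and \<open>l\<close> residues,
  with \<open>k\<close> equal to \<open>l\<close> or \<open>Suc l\<close> according to parity.
  \<open>saw d\<close> is linear on each piece, so both sums are quadratic.\<close>

lemma sum_saw_squared:
  assumes "d > 0"
  shows "(\<Sum>r<d. (saw d r)\<^sup>2) = ((real d)\<^sup>2 + (if even d then 2 else -1)) / (12 * real d)"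
proof -
  have low: "saw d r = - real r / real d" if "d = k + l" "k = l \<or> k = Suc l" "r < k" for k l r
    using that by (auto simp: saw_less)
  have high: "saw d (k + r) = (real l - real r) / real d"
    if "d = k + l" "k = l \<or> k = Suc l" "r < l" for k l r
  proof -
    have "real d = real k + real l" using that by simp
    moreover have "saw d (k + r) = 1 - real (k + r) / real d"
      using that by (auto simp: saw_less)
    moreover have "\<dots> = (real d - real (k + r)) / real d"
      using assms by (simp only: diff_divide_distrib) simp
    ultimately show ?thesis by (metis add_diff_cancel_left diff_diff_eq of_nat_add)
  qed
  \<comment> \<open>Coefficients 0 and 1 are written out so that the sums match
    \<open>sum_quadratic\<close>.\<close>
  have split: "(\<Sum>r<d. (saw d r)\<^sup>2) =
     ((\<Sum>r<k. 0 + 0 * real r + 1 * (real r)\<^sup>2) +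
      (\<Sum>r<l. (real l)\<^sup>2 + (- 2 * real l) * real r + 1 * (real r)\<^sup>2)) / (real d)\<^sup>2"
    if "d = k + l" "k = l \<or> k = Suc l" for k l
  proof -
    have "(\<Sum>r<d. (saw d r)\<^sup>2) = (\<Sum>r<k. (saw d r)\<^sup>2) + (\<Sum>r<l. (saw d (k + r))\<^sup>2)"
      using sum_lessThan_add[of "\<lambda>r. (saw d r)\<^sup>2" k l] that by simp
    also have "(\<Sum>r<k. (saw d r)\<^sup>2) = (\<Sum>r<k. 0 + 0 * real r + 1 * (real r)\<^sup>2) / (real d)\<^sup>2"
      unfolding sum_divide_distrib by (intro sum.cong refl) (simp add: low[OF that] power_divide)
    also have "(\<Sum>r<l. (saw d (k + r))\<^sup>2) =
        (\<Sum>r<l. (real l)\<^sup>2 + (- 2 * real l) * real r + 1 * (real r)\<^sup>2) / (real d)\<^sup>2"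
      unfolding sum_divide_distrib
      by (intro sum.cong refl) (simp add: high[OF that] power_divide power2_diff)
    finally show ?thesis by (simp only: add_divide_distrib)
  qed
  show ?thesis
  proof (cases "even d")
    case True
    then obtain k where k: "d = k + k" by (metis evenE mult_2)
    with assms have "k > 0" by simp
    have D: "real d = 2 * real k" using k by simp
    show ?thesis
      using True \<open>k > 0\<close> unfolding split[OF k disjI1[OF refl]] sum_quadratic D
      by (simp add: field_simps power2_eq_square)
  next
    case False
    then obtain k where k: "d = Suc k + k" by (metis mult_2 oddE add_Suc Suc_eq_plus1)
    have D: "real k = (real d - 1) / 2" "real (Suc k) = (real d + 1) / 2"
      using k by simp_all
    show ?thesis
      using False assms unfolding split[OF k disjI2[OF refl]] sum_quadratic D
      by (simp add: field_simps power2_eq_square)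
  qed
qed

text \<open>Again the period is split at its middle, here into \<open>Suc k\<close> and
  \<open>k\<close> residues, and the product of the two linear factors is quadratic on each
  piece.\<close>

lemma sum_saw_mult_frac:
  assumes "odd d"
  shows "(\<Sum>r<d. saw d r * (1 / 2 - frac (real r / real d))) = - ((real d)\<^sup>2 - 1) / (24 * real d)"
proof -
  obtain k where k: "d = Suc k + k" using assms by (metis mult_2 oddE add_Suc Suc_eq_plus1)
  have D: "real d = 2 * real k + 1" using k by simp
  have d0: "real d > 0" using k by simp
  have low: "saw d r * (1 / 2 - frac (real r / real d)) =
      (0 + (- real d / 2) * real r + 1 * (real r)\<^sup>2) / (real d)\<^sup>2" if "r < Suc k" for r
  proof -
    have "saw d r = - real r / real d" "frac (real r / real d) = real r / real d"
      using that k by (auto simp: saw_less frac_div_nat)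
    then show ?thesis
      unfolding \<open>saw d r = _\<close> \<open>frac _ = _\<close> using d0 by (simp add: divide_simps) (simp add: algebra_simps power2_eq_square)
  qed
  have high: "saw d (Suc k + r) * (1 / 2 - frac (real (Suc k + r) / real d)) =
      (- real k / 2 + (1 / 2 - real k) * real r + 1 * (real r)\<^sup>2) / (real d)\<^sup>2" if "r < k" for r
  proof -
    have saw: "saw d (Suc k + r) = (real k - real r) / real d"
      using that k d0 by (auto simp: saw_less field_simps)
    have "frac (real (Suc k + r) / real d) = (real k + 1 + real r) / real d"
      using that k by (simp add: frac_div_nat)
    then have frac: "1 / 2 - frac (real (Suc k + r) / real d) = (- 1 / 2 - real r) / real d"
      using d0 by (simp add: field_simps) (simp add: D)
    show ?thesis
      unfolding saw frac using d0 by (simp add: field_simps power2_eq_square)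
  qed
  have D': "real k = (real d - 1) / 2" "real (Suc k) = (real d + 1) / 2"
    using k by simp_all
  have "(\<Sum>r<d. saw d r * (1 / 2 - frac (real r / real d))) =
      (\<Sum>r<Suc k. saw d r * (1 / 2 - frac (real r / real d))) +
      (\<Sum>r<k. saw d (Suc k + r) * (1 / 2 - frac (real (Suc k + r) / real d)))"
    using sum_lessThan_add[of "\<lambda>r. saw d r * (1 / 2 - frac (real r / real d))" "Suc k" k, folded k] .
  also have "(\<Sum>r<Suc k. saw d r * (1 / 2 - frac (real r / real d))) =
      (\<Sum>r<Suc k. 0 + (- real d / 2) * real r + 1 * (real r)\<^sup>2) / (real d)\<^sup>2"
    unfolding sum_divide_distrib by (intro sum.cong refl low) simp
  also have "(\<Sum>r<k. saw d (Suc k + r) * (1 / 2 - frac (real (Suc k + r) / real d))) =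
      (\<Sum>r<k. - real k / 2 + (1 / 2 - real k) * real r + 1 * (real r)\<^sup>2) / (real d)\<^sup>2"
    unfolding sum_divide_distrib by (intro sum.cong refl high) simp
  also have "(\<Sum>r<Suc k. 0 + (- real d / 2) * real r + 1 * (real r)\<^sup>2) / (real d)\<^sup>2 +
      (\<Sum>r<k. - real k / 2 + (1 / 2 - real k) * real r + 1 * (real r)\<^sup>2) / (real d)\<^sup>2 =
      - ((real d)\<^sup>2 - 1) / (24 * real d)"
    unfolding sum_quadratic D' using d0 by (simp add: field_simps power2_eq_square)
  finally show ?thesis .
qed

section \<open>Limits of the mean terms\<close>

lemma mean_term_commute: "mean_term m n X = mean_term n m X"
  by (simp add: mean_term_def algebra_simps)

text \<open>Here \<open>d\<close> is the gcd of the two indices. The product of the two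
  \<open>saw\<close> functions has period \<open>d * (a * b)\<close>, their lcm, so the limit is the
  average over that period, which is then split by residues modulo \<open>d\<close>.\<close>

lemma tendsto_mean_term:
  assumes "coprime a b" "a > 0" "b > 0" "d > 0"
  shows "mean_term (d * a) (d * b) \<longlonglongrightarrow>
    real_of_int (moebius_mu (d * a)) * real_of_int (moebius_mu (d * b)) / (real (d * a) * real (d * b)) *
    ((\<Sum>r<d. (\<Sum>i<a. saw (d * a) (r + d * i)) * (\<Sum>i<b. saw (d * b) (r + d * i))) / real (d * (a * b)))"
proof -
  let ?c = "real_of_int (moebius_mu (d * a)) * real_of_int (moebius_mu (d * b)) / (real (d * a) * real (d * b))"
  let ?F = "\<lambda>x. saw (d * a) x * saw (d * b) x"
  have per: "saw n (x mod N) = saw n x" if "n dvd N" for n N x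
    using saw_mod[of n "x mod N"] saw_mod[of n x] that by (simp add: mod_mod_cancel)
  have "(\<lambda>X. (\<Sum>x=1..X. ?F x) / real X) \<longlonglongrightarrow> sum ?F {..<d * (a * b)} / real (d * (a * b))"
    by (rule tendsto_mean_periodic) (use assms in \<open>simp_all add: per\<close>)
  then have "(\<lambda>X. ?c * ((\<Sum>x=1..X. ?F x) / real X)) \<longlonglongrightarrow> ?c * (sum ?F {..<d * (a * b)} / real (d * (a * b)))"
    by (rule tendsto_mult_left)
  also have "(\<lambda>X. ?c * ((\<Sum>x=1..X. ?F x) / real X)) = mean_term (d * a) (d * b)"
    unfolding mean_term_def sum_distrib_left[symmetric]
    by (intro ext) (simp add: saw_def algebra_simps)
  also have "sum ?F {..<d * (a * b)} =
      (\<Sum>r<d. (\<Sum>i<a. saw (d * a) (r + d * i)) * (\<Sum>i<b. saw (d * b) (r + d * i)))"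
    by (rule sum_mult_periodic) (use assms in \<open>auto simp: saw_mod\<close>)
  finally show ?thesis .
qed

lemma convergent_mean_term:
  assumes "m \<ge> 1" "n \<ge> 1"
  shows "convergent (mean_term m n)"
proof -
  have "m = gcd m n * (m div gcd m n)" "n = gcd m n * (n div gcd m n)" by simp_all
  moreover have "coprime (m div gcd m n) (n div gcd m n)"
    using assms by (intro div_gcd_coprime) auto
  moreover from calculation have "m div gcd m n > 0" "n div gcd m n > 0"
    using assms by (metis gr0I mult_0_right not_one_le_zero)+
  ultimately show ?thesis
    using tendsto_mean_term[of "m div gcd m n" "n div gcd m n" "gcd m n"] assms
    by (auto simp: convergent_def)
qed

text \<open>In the three cases the gcd of the indices is \<open>d\<close>, \<open>d\<close> and
  \<open>2 * d\<close>. Only the second has an even cofactor, \<open>2 * a\<close>, so it leads to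
  the mixed sum and the others to sums of squares. Each doubled index flips the sign of its Moebius
  factor.\<close>

lemma tendsto_mean_term_odd:
  assumes "odd d" "odd a" "odd b" "coprime a b"
  defines "w \<equiv> real_of_int (moebius_mu (d * a)) * real_of_int (moebius_mu (d * b))"
    and "l \<equiv> real (d * a * b)" and "p \<equiv> real (d * a) * real (d * b)"
  shows "mean_term (d * a) (d * b) \<longlonglongrightarrow> w / l\<^sup>2 / 12 - w / p\<^sup>2 / 12"
    and "mean_term (2 * (d * a)) (d * b) \<longlonglongrightarrow> w / l\<^sup>2 / 96 - w / p\<^sup>2 / 96"
    and "mean_term (2 * (d * a)) (2 * (d * b)) \<longlonglongrightarrow> w / l\<^sup>2 / 48 + w / p\<^sup>2 / 96"
proof -
  have pos: "d > 0" "2 * d > 0" "a > 0" "b > 0" using assms odd_pos by auto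
  have odd_prod: "odd (d * a)" "odd (d * b)" using assms by auto
  have odd_sum: "(\<Sum>i<k. saw (e * k) (r + e * i)) = saw e r" if "odd k" "e > 0" for k e r
    using that by (rule sum_saw_odd)
  have "mean_term (d * a) (d * b) \<longlonglongrightarrow> w / p * ((\<Sum>r<d. (saw d r)\<^sup>2) / real (d * (a * b)))"
    using tendsto_mean_term[of a b d] assms pos by (simp add: odd_sum power2_eq_square)
  \<comment> \<open>Since \<open>p = d * l\<close>, the terms \<open>d^2\<close> and
    \<open>-1\<close> of the closed form turn into \<open>1 / l^2\<close> and
    \<open>1 / p^2\<close>; the other two cases work alike.\<close>
  also have "w / p * ((\<Sum>r<d. (saw d r)\<^sup>2) / real (d * (a * b))) = w / l\<^sup>2 / 12 - w / p\<^sup>2 / 12"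
    unfolding sum_saw_squared[OF \<open>d > 0\<close>] l_def p_def
    using pos \<open>odd d\<close> by (simp add: field_simps power2_eq_square)
  finally show "mean_term (d * a) (d * b) \<longlonglongrightarrow> w / l\<^sup>2 / 12 - w / p\<^sup>2 / 12" .
  have even_sum: "(\<Sum>i<2 * a. saw (2 * (d * a)) (r + d * i)) = 1 / 2 - frac (real r / real d)" for r
    using sum_saw_even[of a d r] pos by (simp only: mult.left_commute)
  have "mean_term (d * (2 * a)) (d * b) \<longlonglongrightarrow> - w / (2 * p) *
      ((\<Sum>r<d. saw d r * (1 / 2 - frac (real r / real d))) / real (d * (2 * a * b)))"
    using tendsto_mean_term[of "2 * a" b d] assms pos
    by (simp add: odd_sum even_sum mult.left_commute[of d 2] moebius_mu_double mult.commute[of "saw _ _"])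
  also have "- w / (2 * p) * ((\<Sum>r<d. saw d r * (1 / 2 - frac (real r / real d))) / real (d * (2 * a * b)))
      = w / l\<^sup>2 / 96 - w / p\<^sup>2 / 96"
    unfolding sum_saw_mult_frac[OF \<open>odd d\<close>] l_def p_def
    using pos by (simp add: field_simps power2_eq_square)
  finally show "mean_term (2 * (d * a)) (d * b) \<longlonglongrightarrow> w / l\<^sup>2 / 96 - w / p\<^sup>2 / 96"
    by (simp add: mult.left_commute)
  have "mean_term (2 * d * a) (2 * d * b) \<longlonglongrightarrow> w / (4 * p) *
      ((\<Sum>r<2 * d. (saw (2 * d) r)\<^sup>2) / real (2 * d * (a * b)))"
    using tendsto_mean_term[of a b "2 * d"] assms pos odd_prod
    by (simp add: odd_sum[of _ "2 * d", unfolded mult.assoc] moebius_mu_double mult.assoc power2_eq_square)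
  also have "w / (4 * p) * ((\<Sum>r<2 * d. (saw (2 * d) r)\<^sup>2) / real (2 * d * (a * b)))
      = w / l\<^sup>2 / 48 + w / p\<^sup>2 / 96"
    unfolding sum_saw_squared[OF \<open>2 * d > 0\<close>] l_def p_def
    using pos by (simp add: field_simps power2_eq_square)
  finally show "mean_term (2 * (d * a)) (2 * (d * b)) \<longlonglongrightarrow> w / l\<^sup>2 / 48 + w / p\<^sup>2 / 96"
    by (simp add: mult.assoc)
qed

lemma lim_mean_term_odd:
  fixes m n :: nat
  assumes "odd m" "odd n"
  defines "w \<equiv> real_of_int (moebius_mu m) * real_of_int (moebius_mu n)"
    and "l \<equiv> real (lcm m n)" and "p \<equiv> real m * real n"
  shows "lim (mean_term m n) = w / l\<^sup>2 / 12 - w / p\<^sup>2 / 12"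
    and "lim (mean_term (2 * m) n) = w / l\<^sup>2 / 96 - w / p\<^sup>2 / 96"
    and "lim (mean_term m (2 * n)) = w / l\<^sup>2 / 96 - w / p\<^sup>2 / 96"
    and "lim (mean_term (2 * m) (2 * n)) = w / l\<^sup>2 / 48 + w / p\<^sup>2 / 96"
proof -
  define d where "d = gcd m n"
  obtain a b where ab: "m = d * a" "n = d * b"
    unfolding d_def by (meson dvd_def gcd_dvd1 gcd_dvd2)
  have "d \<noteq> 0" using assms d_def by auto
  then have cop: "coprime a b"
    using gcd_mult_distrib_nat[of d a b] by (simp add: coprime_iff_gcd_eq_1 flip: ab d_def)
  then have l: "l = real (d * a * b)"
    by (simp add: l_def ab lcm_mult_left lcm_coprime)
  have odd: "odd d" "odd a" "odd b" using assms(1,2) ab by auto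
  note lims = tendsto_mean_term_odd[OF odd cop, folded ab l, folded w_def p_def]
  show "lim (mean_term m n) = w / l\<^sup>2 / 12 - w / p\<^sup>2 / 12"
    and "lim (mean_term (2 * m) n) = w / l\<^sup>2 / 96 - w / p\<^sup>2 / 96"
    and "lim (mean_term (2 * m) (2 * n)) = w / l\<^sup>2 / 48 + w / p\<^sup>2 / 96"
    by (rule limI, rule lims)+
  \<comment> \<open>The case \<open>(m, 2 * n)\<close> follows by symmetry from the case of a
    doubled first index, with \<open>a\<close> and \<open>b\<close> exchanged.\<close>
  have "coprime b a" using cop by (simp add: coprime_commute)
  from tendsto_mean_term_odd(2)[OF odd(1,3,2) this]
  have "mean_term (2 * n) m \<longlonglongrightarrow> w / l\<^sup>2 / 96 - w / p\<^sup>2 / 96"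
    by (simp add: ab l w_def p_def mult_ac)
  then show "lim (mean_term m (2 * n)) = w / l\<^sup>2 / 96 - w / p\<^sup>2 / 96"
    by (intro limI) (simp add: mean_term_commute[of m "2 * n", abs_def])
qed

section \<open>Summation over all pairs\<close>

theorem theorem2p2:
  shows "(\<forall>m\<ge>1. \<forall>n\<ge>1. convergent (mean_term m n)) \<and>
    ((\<lambda>(m, n). lim (mean_term m n)) has_sum
       (1 / (6 * riemann_zeta 2) - 1 / (6 * (riemann_zeta 2)\<^sup>2))) ({1..} \<times> {1..})"
proof
  show "\<forall>m\<ge>1. \<forall>n\<ge>1. convergent (mean_term m n)"
    using convergent_mean_term by blast
  define S where "S = {k::nat. odd k}"
  define t where "t = (\<lambda>(m, n). lim (mean_term m n))"
  define A where "A = 4 / (3 * riemann_zeta 2)"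
  define \<alpha> where "\<alpha> = (\<lambda>(m, n). real_of_int (moebius_mu m) * real_of_int (moebius_mu n) / (real (lcm m n))\<^sup>2)"
  define \<beta> where "\<beta> = (\<lambda>(m, n). real_of_int (moebius_mu m) * real_of_int (moebius_mu n) / (real m * real n)\<^sup>2)"
  have \<alpha>: "(\<alpha> has_sum A) (S \<times> S)"
    using has_sum_odd_moebius_mu_lcm by (simp add: \<alpha>_def A_def S_def)
  have \<beta>: "(\<beta> has_sum A\<^sup>2) (S \<times> S)"
    using has_sum_Times[OF has_sum_odd_moebius_mu has_sum_odd_moebius_mu]
    by (simp add: \<beta>_def A_def S_def power_mult_distrib power_divide power2_eq_square[of "riemann_zeta 2"])
  \<comment> \<open>\<open>f\<close> and \<open>g\<close> will each be the identity or doubling, so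
    the images of \<open>S \<times> S\<close> are the four classes of pairs in which each index is
    odd or twice an odd number.\<close>
  have part: "(t has_sum (x * A + y * A\<^sup>2)) (f ` S \<times> g ` S)"
    if lim: "\<And>m n. odd m \<Longrightarrow> odd n \<Longrightarrow> lim (mean_term (f m) (g n)) = x * \<alpha> (m, n) + y * \<beta> (m, n)"
      and "inj f" "inj g" for f g x y
  proof -
    have "((\<lambda>i. x * \<alpha> i + y * \<beta> i) has_sum (x * A + y * A\<^sup>2)) (S \<times> S)"
      by (intro has_sum_add has_sum_cmult_right \<alpha> \<beta>)
    then have "((t \<circ> map_prod f g) has_sum (x * A + y * A\<^sup>2)) (S \<times> S)"
      by (rule has_sum_cong[THEN iffD1, rotated]) (auto simp: lim t_def S_def)
    moreover have "inj_on (map_prod f g) (S \<times> S)"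
      using prod.inj_map[OF \<open>inj f\<close> \<open>inj g\<close>] by (rule inj_on_subset) simp
    ultimately show ?thesis
      by (simp add: has_sum_reindex flip: map_prod_surj_on[OF refl refl])
  qed
  let ?E = "(*) 2 ` S"
  have inj: "inj ((*) (2::nat))" "inj (id :: nat \<Rightarrow> nat)" by (auto intro: injI)
  note lims = lim_mean_term_odd \<alpha>_def \<beta>_def
  have "(t has_sum (1/12 * A + (-1/12) * A\<^sup>2)) (id ` S \<times> id ` S)"
    by (rule part) (simp_all add: lims inj)
  then have oo: "(t has_sum (1/12 * A + (-1/12) * A\<^sup>2)) (S \<times> S)"
    by simp
  have "(t has_sum (1/96 * A + (-1/96) * A\<^sup>2)) (?E \<times> id ` S)"
    by (rule part) (simp_all add: lims inj)
  then have eo: "(t has_sum (1/96 * A + (-1/96) * A\<^sup>2)) (?E \<times> S)"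
    by simp
  have "(t has_sum (1/96 * A + (-1/96) * A\<^sup>2)) (id ` S \<times> ?E)"
    by (rule part) (simp_all add: lims inj)
  then have oe: "(t has_sum (1/96 * A + (-1/96) * A\<^sup>2)) (S \<times> ?E)"
    by simp
  have ee: "(t has_sum (1/48 * A + 1/96 * A\<^sup>2)) (?E \<times> ?E)"
    by (rule part) (simp_all add: lims inj)
  have disj: "S \<inter> ?E = {}" by (auto simp: S_def)
  let ?U = "(S \<times> S \<union> S \<times> ?E) \<union> (?E \<times> S \<union> ?E \<times> ?E)"
  have "(t has_sum ((1/12 * A + (-1/12) * A\<^sup>2) + (1/96 * A + (-1/96) * A\<^sup>2) +
      ((1/96 * A + (-1/96) * A\<^sup>2) + (1/48 * A + 1/96 * A\<^sup>2)))) ?U"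
    by (intro has_sum_Un_disjoint oo oe eo ee) (use disj in blast)+
  \<comment> \<open>The coefficients add up to \<open>A / 8 - 3 * A^2 / 32\<close>, and
    \<open>A = 4 / (3 * riemann_zeta 2)\<close> gives the stated value.\<close>
  also have "(1/12 * A + (-1/12) * A\<^sup>2) + (1/96 * A + (-1/96) * A\<^sup>2) +
      ((1/96 * A + (-1/96) * A\<^sup>2) + (1/48 * A + 1/96 * A\<^sup>2)) =
      1 / (6 * riemann_zeta 2) - 1 / (6 * (riemann_zeta 2)\<^sup>2)"
    by (simp add: A_def power_divide power_mult_distrib)
  also have "(t has_sum (1 / (6 * riemann_zeta 2) - 1 / (6 * (riemann_zeta 2)\<^sup>2))) ?U \<longleftrightarrow>
    (t has_sum (1 / (6 * riemann_zeta 2) - 1 / (6 * (riemann_zeta 2)\<^sup>2))) ({1..} \<times> {1..})"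
  \<comment> \<open>A pair of positive integers outside the four classes has an index divisible by
    4; there \<open>moebius_mu\<close> vanishes, so \<open>mean_term\<close> is identically
    0.\<close>
  proof (rule has_sum_cong_neutral)
    have zero: "moebius_mu k = 0" if k: "k \<notin> S \<union> ?E" for k
    proof -
      have "even k" using k by (simp add: S_def)
      then obtain j where "k = 2 * j" by (elim evenE)
      moreover from this k have "even j" by (auto simp: S_def)
      ultimately show ?thesis by (simp add: moebius_mu_double)
    qed
    fix p :: "nat \<times> nat" assume "p \<in> {1..} \<times> {1..} - ?U"
    then obtain m n where p: "p = (m, n)" "moebius_mu m = 0 \<or> moebius_mu n = 0"
      using zero by (cases p) blast
    then have "mean_term m n = (\<lambda>_. 0)" by (auto simp: mean_term_def)
    with p show "t p = 0" by (simp add: t_def)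
  next
    have "S \<subseteq> {1..}" "?E \<subseteq> {1..}" by (auto simp: S_def Suc_le_eq odd_pos)
    then show "t p = 0" if "p \<in> ?U - {1..} \<times> {1..}" for p
      using that by blast
  qed simp
  finally show "((\<lambda>(m, n). lim (mean_term m n)) has_sum
       (1 / (6 * riemann_zeta 2) - 1 / (6 * (riemann_zeta 2)\<^sup>2))) ({1..} \<times> {1..})"
    by (simp add: t_def)
qed

end
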